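(* Let $(S,\Sigma,\mu)$ be a $\sigma$-finite measure space, let $b\in L^\infty(S,\Sigma,\mu)$ satisfy $0<b(s)\le \overline b<\infty$ for $\mu$-almost every $s\in S$ (for some constant $\overline b$) and $\operatorname{essinf}_{s\in S} b(s)=0$, and let $\delta>0$. Let $\varphi$ be an index function, and suppose that $f\in L^2(S,\Sigma,\mu)$ satisfies the source condition with respect to $\varphi$ and $b$. Let $(\Phi_\alpha)_{\alpha>0}$ be a regularization (with constants $C_{-1}$, $C_0$) that has qualification $\varphi$ (with constant $C_\varphi$). Suppose in addition that: (1) if $\mu(S)=\infty$, then $b$ vanishes at infinity, i.e. $\mu(\{s\in S: b(s)>t\})<\infty$ for every $t>0$; (2) for each $\alpha>0$ the function $\Phi_\alpha$ vanishes on $\{t\ge 0: t\le\alpha\}$. Let the data be $g^\delta=bf+\delta\xi$ with white noise $\xi$, and let $f^\delta_\alpha:=\Phi_\alpha(b)\,g^\delta$. Then $$\mathbb{E}\,\|f-f^\delta_\alpha\|_{L^2(S,\Sigma,\mu)}^2\le C_\varphi^2\,\varphi(\alpha)^2+\delta^2(C_0+1)^2D^2(\alpha),\qquad\alpha>0,$$ where $D$ is the statistical effective ill-posedness. Moreover, the a priori parameter choice $\alpha_*=\alpha_*(\varphi,D,\delta)$ obtained by solving the equation $\varphi(\alpha)=\delta D(\alpha)$ yields, for $\alpha=\alpha_*$, the error bound $$\left(\mathbb{E}\,\|f-f^\delta_{\alpha_*}\|_{L^2(S,\Sigma,\mu)}^2\right)^{1/2}\le\sqrt2\,\max\{C_\varphi,\,C_0+1\}\,\varphi(\alpha_*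 ).$$
   Context: An index function is a strictly increasing continuous function $\varphi:(0,\infty)\to[0,\infty)$ with $\lim_{t\to+0}\varphi(t)=0$; one sets $\varphi(0):=0$. Source condition: $f\in L^2(S,\Sigma,\mu)$ obeys a source condition with respect to the index function $\varphi$ and the multiplier function $b$ if $f(s)=\varphi(b(s))\,v(s)$ for $\mu$-a.e. $s\in S$, for some $v$ with $\|v\|_{L^2(S,\Sigma,\mu)}\le 1$. Regularization: a family $(\Phi_\alpha)_{\alpha>0}$ of real-valued Borel-measurable functions $\Phi_\alpha(t)$, $t\ge 0$, is called a regularization if there are constants $C_{-1}>0$ and $C_0\ge 1$ such that (I) for each $t>0$, $t\Phi_\alpha(t)\to 1$ as $\alpha\to 0$; (II) $|\Phi_\alpha(t)|\le C_{-1}/\alpha$ for all $t\ge0$ and $\alpha>0$; (III) the residual function $R_\alpha(t):=1-t\Phi_\alpha(t)$ satisfies $|R_\alpha(t)|\le C_0$ for all $t\ge 0$ and $\alpha>0$. Qualification: a regularization $(\Phi_\alpha)$ has qualification $\varphi$ (an index function) if there is a constant $C_\varphi>0$ such that $\sup_{t\ge 0}|R_\alpha(t)|\,\varphi(t)\le C_\varphi\,\varphi(\alpha)$ for all $\alpha>0$. Notation: $[\Phi_\alpha(b)](s):=\Phi_\alpha(b(s))$, so $f^\delta_\alpha(s)=\Phi_\alpha(b(s))\,g^\delta(s)$. White noise: there is a probability space $(\Omega,\mathcal F,P)$ such that $\{\xi_s\}_{s\in S}$, $\xi_s=\xi(s):\Omega\to\mathbb{R}$, is a centered stochastic process with $\mathbb{E}\,\xi_s=0$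 and $\mathbb{E}|\xi_s|^2=1$ for all $s\in S$; the process is taken to be jointly measurable in $(s,\omega)$, so that expectation and integration over $S$ may be interchanged. $\mathbb{E}$ denotes expectation with respect to $P$. Decreasing rearrangement: with $d_b(t):=\mu(\{s\in S: b(s)>t\})$ for $t>0$, put $b_*(t):=\inf\{\tau>0: d_b(\tau)\le t\}$ for $0<t<\mu(S)$; $b_*$ is considered on $[0,\mu(S))$ equipped with Lebesgue measure $\lambda$. Statistical effective ill-posedness: $D(\alpha):=\left(\int_{\{b_*>\alpha\}}\frac{1}{|b_*(t)|^2}\,d\lambda(t)\right)^{1/2}$, $\alpha>0$. *)

theory Defs
  imports "HOL-Probability.Probability" "HOL-Probability.Essential_Supremum"
begin

definition ennsqrt :: "ennreal \<Rightarrow> ennreal" where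
  "ennsqrt x = (if x = \<infinity> then \<infinity> else ennreal (sqrt (enn2real x)))"

text \<open>The L2 norm takes values in \<open>[0, \<infinity>]\<close>, so that a function outside L2 has norm
  \<open>\<infinity>\<close> and no bound below can hold because a non-integrable integrand was assigned
  the value 0.\<close>

definition L2_norm :: "'a measure \<Rightarrow> ('a \<Rightarrow> real) \<Rightarrow> ennreal" where
  "L2_norm M h = ennsqrt (\<integral>\<^sup>+ s. ennreal ((h s)\<^sup>2) \<partial>M)"

definition L2_space :: "'a measure \<Rightarrow> ('a \<Rightarrow> real) set" where
  "L2_space M = {h. h \<in> borel_measurable M \<and> L2_norm M h < \<infinity>}"

definition essinf :: "'a measure \<Rightarrow> ('a \<Rightarrow> real) \<Rightarrow> ereal" where
  "essinf M h = - esssup M (\<lambda>s. - ereal (h s))"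

definition index_function :: "(real \<Rightarrow> real) \<Rightarrow> bool" where
  "index_function \<phi> \<longleftrightarrow>
     (\<forall>t>0. \<phi> t \<ge> 0) \<and> strict_mono_on {0<..} \<phi> \<and> continuous_on {0<..} \<phi> \<and>
     (\<phi> \<longlongrightarrow> 0) (at_right 0) \<and> \<phi> 0 = 0"

definition source_condition ::
  "'a measure \<Rightarrow> (real \<Rightarrow> real) \<Rightarrow> ('a \<Rightarrow> real) \<Rightarrow> ('a \<Rightarrow> real) \<Rightarrow> bool" where
  "source_condition M \<phi> b f \<longleftrightarrow>
     (\<exists>v \<in> L2_space M. L2_norm M v \<le> 1 \<and> (AE s in M. f s = \<phi> (b s) * v s))"

definition residual :: "(real \<Rightarrow> real \<Rightarrow> real) \<Rightarrow> real \<Rightarrow> real \<Rightarrow> real" where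
  "residual \<Phi> \<alpha> t = 1 - t * \<Phi> \<alpha> t"

definition regularization :: "(real \<Rightarrow> real \<Rightarrow> real) \<Rightarrow> real \<Rightarrow> real \<Rightarrow> bool" where
  "regularization \<Phi> Cm1 C0 \<longleftrightarrow>
     Cm1 > 0 \<and> C0 \<ge> 1 \<and>
     (\<forall>\<alpha>>0. \<Phi> \<alpha> \<in> borel_measurable (restrict_space borel {0..})) \<and>
     (\<forall>t>0. ((\<lambda>\<alpha>. t * \<Phi> \<alpha> t) \<longlongrightarrow> 1) (at_right 0)) \<and>
     (\<forall>\<alpha>>0. \<forall>t\<ge>0. \<bar>\<Phi> \<alpha> t\<bar> \<le> Cm1 / \<alpha>) \<and>
     (\<forall>\<alpha>>0. \<forall>t\<ge>0. \<bar>residual \<Phi> \<alpha> t\<bar> \<le> C0)"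

definition has_qualification ::
  "(real \<Rightarrow> real \<Rightarrow> real) \<Rightarrow> (real \<Rightarrow> real) \<Rightarrow> real \<Rightarrow> bool" where
  "has_qualification \<Phi> \<phi> C\<phi> \<longleftrightarrow>
     index_function \<phi> \<and> C\<phi> > 0 \<and>
     (\<forall>\<alpha>>0. (SUP t\<in>{0..}. ereal (\<bar>residual \<Phi> \<alpha> t\<bar> * \<phi> t)) \<le> ereal (C\<phi> * \<phi> \<alpha>))"

definition white_noise ::
  "'a measure \<Rightarrow> 'w measure \<Rightarrow> ('a \<Rightarrow> 'w \<Rightarrow> real) \<Rightarrow> bool" where
  "white_noise M P \<xi> \<longleftrightarrow>
     prob_space P \<and>
     (\<lambda>(s, \<omega>). \<xi> s \<omega>) \<in> borel_measurable (M \<Otimes>\<^sub>M P) \<and>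
     (\<forall>s\<in>space M. integrable P (\<xi> s) \<and> (\<integral>\<omega>. \<xi> s \<omega> \<partial>P) = 0) \<and>
     (\<forall>s\<in>space M. integrable P (\<lambda>\<omega>. (\<xi> s \<omega>)\<^sup>2) \<and> (\<integral>\<omega>. (\<xi> s \<omega>)\<^sup>2 \<partial>P) = 1)"

definition distribution_fun :: "'a measure \<Rightarrow> ('a \<Rightarrow> real) \<Rightarrow> real \<Rightarrow> ennreal" where
  "distribution_fun M b t = emeasure M {s \<in> space M. b s > t}"

definition decreasing_rearrangement :: "'a measure \<Rightarrow> ('a \<Rightarrow> real) \<Rightarrow> real \<Rightarrow> real" where
  "decreasing_rearrangement M b t = Inf {\<tau>. \<tau> > 0 \<and> distribution_fun M b \<tau> \<le> ennreal t}"

text \<open>If \<open>b\<close> is essentially bounded and \<open>distribution_fun M b\<close> is finite on the positive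
  half-line, the integrand below is bounded by \<open>1 / \<alpha>\<^sup>2\<close> on a set of finite measure
  \<open>distribution_fun M b \<alpha>\<close>, so the Bochner integral is the true one.\<close>

definition stat_eff_illposedness :: "'a measure \<Rightarrow> ('a \<Rightarrow> real) \<Rightarrow> real \<Rightarrow> real" where
  "stat_eff_illposedness M b \<alpha> =
     sqrt (LINT t:{t. 0 \<le> t \<and> ennreal t < emeasure M (space M) \<and>
                      decreasing_rearrangement M b t > \<alpha>}|lborel.
             1 / \<bar>decreasing_rearrangement M b t\<bar>\<^sup>2)"

definition noisy_data ::
  "('a \<Rightarrow> real) \<Rightarrow> ('a \<Rightarrow> real) \<Rightarrow> real \<Rightarrow> ('a \<Rightarrow> 'w \<Rightarrow> real) \<Rightarrow> 'w \<Rightarrow> 'a \<Rightarrow> real" where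
  "noisy_data b f \<delta> \<xi> \<omega> s = b s * f s + \<delta> * \<xi> s \<omega>"

definition reconstruction ::
  "(real \<Rightarrow> real \<Rightarrow> real) \<Rightarrow> real \<Rightarrow> ('a \<Rightarrow> real) \<Rightarrow> ('a \<Rightarrow> real) \<Rightarrow> 'a \<Rightarrow> real" where
  "reconstruction \<Phi> \<alpha> b g s = \<Phi> \<alpha> (b s) * g s"

definition mean_square_error ::
  "'a measure \<Rightarrow> 'w measure \<Rightarrow> ('a \<Rightarrow> real) \<Rightarrow> ('w \<Rightarrow> 'a \<Rightarrow> real) \<Rightarrow> ennreal" where
  "mean_square_error M P f F = (\<integral>\<^sup>+ \<omega>. (L2_norm M (\<lambda>s. f s - F \<omega> s))\<^sup>2 \<partial>P)"

end

theory Submission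
  imports Defs
begin

text \<open>
  Write \<open>R = residual \<Phi> \<alpha>\<close>. The error \<open>f - \<Phi>\<^sub>\<alpha>(b) (b f + \<delta> \<xi>)\<close> equals
  \<open>R(b) f - \<delta> \<Phi>\<^sub>\<alpha>(b) \<xi>\<close>. At each point \<open>s\<close> the noise is centered with unit variance, so the
  cross term has mean zero; Tonelli's theorem then turns the mean square error into the sum of a
  squared bias \<open>\<integral> R(b)\<^sup>2 f\<^sup>2 d\<mu>\<close> and a variance \<open>\<delta>\<^sup>2 \<integral> \<Phi>\<^sub>\<alpha>(b)\<^sup>2 d\<mu>\<close>
  (\<open>bias_variance_decomposition\<close>).

  The source condition \<open>f = \<phi>(b) v\<close> with \<open>\<parallel>v\<parallel> \<le> 1\<close> and the qualification
  \<open>\<bar>R(t)\<bar> \<phi>(t) \<le> C\<^sub>\<phi> \<phi>(\<alpha>)\<close> bound the squared bias by \<open>C\<^sub>\<phi>\<^sup>2 \<phi>(\<alpha>)\<^sup>2\<close>.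
  For the variance, \<open>\<Phi>\<^sub>\<alpha>(b)\<close> vanishes where \<open>b \<le> \<alpha>\<close>, while elsewhere
  \<open>\<bar>b \<Phi>\<^sub>\<alpha>(b)\<bar> = \<bar>1 - R(b)\<bar> \<le> C\<^sub>0 + 1\<close>; so it is at most
  \<open>\<delta>\<^sup>2 (C\<^sub>0 + 1)\<^sup>2\<close> times the integral of \<open>1 / b\<^sup>2\<close> over \<open>{b > \<alpha>}\<close>.

  That integral is \<open>D(\<alpha>)\<^sup>2\<close> because \<open>b\<close> and its decreasing rearrangement are equimeasurable:
  \<open>b\<^sub>*(t) > \<tau>\<close> holds exactly when \<open>t < d\<^sub>b(\<tau>)\<close>, so both functions, cut off at level \<open>\<alpha>\<close>,
  have the same image measure on the real line (\<open>distr_decreasing_rearrangement\<close>), which is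
  finite because \<open>d\<^sub>b(\<alpha>) < \<infinity>\<close>. Balancing \<open>\<phi>(\<alpha>) = \<delta> D(\<alpha>)\<close> in the sum of the two
  bounds gives the factor \<open>\<surd>2\<close> of the a priori choice.
\<close>

section \<open>The extended square root\<close>

lemma ennsqrt_power2: "(ennsqrt x)\<^sup>2 = x"
  by (cases x) (auto simp: ennsqrt_def ennreal_power power2_eq_square ennreal_mult_top
      simp flip: ennreal_mult)

lemma ennsqrt_le_iff:
  assumes "0 \<le> c"
  shows "ennsqrt x \<le> ennreal c \<longleftrightarrow> x \<le> ennreal (c\<^sup>2)"
  using assms
  by (cases x) (auto simp: ennsqrt_def top_unique ennreal_le_iff real_sqrt_le_iff'
      intro: real_le_lsqrt)

lemma L2_norm_power2: "(L2_norm M h)\<^sup>2 = (\<integral>\<^sup>+ s. ennreal ((h s)\<^sup>2) \<partial>M)"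
  by (simp add: L2_norm_def ennsqrt_power2)

section \<open>Bias and variance\<close>

lemma (in prob_space) nn_integral_power2_affine:
  assumes "integrable M X" "expectation X = 0"
    and "integrable M (\<lambda>\<omega>. (X \<omega>)\<^sup>2)" "expectation (\<lambda>\<omega>. (X \<omega>)\<^sup>2) = 1"
  shows "(\<integral>\<^sup>+ \<omega>. ennreal ((u - w * X \<omega>)\<^sup>2) \<partial>M) = ennreal (u\<^sup>2) + ennreal (w\<^sup>2)"
proof -
  have eq: "(u - w * X \<omega>)\<^sup>2 = u\<^sup>2 - 2 * u * w * X \<omega> + w\<^sup>2 * (X \<omega>)\<^sup>2" for \<omega>
    by (simp add: power2_eq_square algebra_simps)
  have int: "integrable M (\<lambda>\<omega>. (u - w * X \<omega>)\<^sup>2)"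
    unfolding eq using assms by (intro Bochner_Integration.integrable_add
        Bochner_Integration.integrable_diff integrable_mult_right integrable_const) auto
  have "expectation (\<lambda>\<omega>. (u - w * X \<omega>)\<^sup>2) = u\<^sup>2 + w\<^sup>2"
    unfolding eq using assms by (simp add: prob_space)
  then show ?thesis
    using nn_integral_eq_integral[OF int] by simp
qed

text \<open>Tonelli's theorem brings the expectation inside, where the noise enters at a single point
  at a time and only through its first two moments.\<close>

lemma bias_variance_decomposition:
  assumes "sigma_finite_measure M" and wn: "white_noise M P \<xi>"
    and [measurable]: "u \<in> borel_measurable M" "w \<in> borel_measurable M"
  shows "(\<integral>\<^sup>+ \<omega>. (L2_norm M (\<lambda>s. u s - w s * \<xi> s \<omega>))\<^sup>2 \<partial>P) =
    (\<integral>\<^sup>+ s. ennreal ((u s)\<^sup>2) \<partial>M) + (\<integral>\<^sup>+ s. ennreal ((w s)\<^sup>2) \<partial>M)"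
proof -
  interpret P: prob_space P using wn by (simp add: white_noise_def)
  interpret M: sigma_finite_measure M by fact
  interpret pair_sigma_finite M P ..
  have [measurable]: "(\<lambda>(s, \<omega>). \<xi> s \<omega>) \<in> borel_measurable (M \<Otimes>\<^sub>M P)"
    using wn by (simp add: white_noise_def)
  have "(\<integral>\<^sup>+ \<omega>. (L2_norm M (\<lambda>s. u s - w s * \<xi> s \<omega>))\<^sup>2 \<partial>P) =
      (\<integral>\<^sup>+ \<omega>. \<integral>\<^sup>+ s. ennreal ((u s - w s * \<xi> s \<omega>)\<^sup>2) \<partial>M \<partial>P)"
    by (simp add: L2_norm_power2)
  also have "\<dots> = (\<integral>\<^sup>+ s. \<integral>\<^sup>+ \<omega>. ennreal ((u s - w s * \<xi> s \<omega>)\<^sup>2) \<partial>P \<partial>M)"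
    by (rule Fubini') measurable
  also have "\<dots> = (\<integral>\<^sup>+ s. ennreal ((u s)\<^sup>2) + ennreal ((w s)\<^sup>2) \<partial>M)"
    using wn by (intro nn_integral_cong P.nn_integral_power2_affine)
      (auto simp: white_noise_def)
  also have "\<dots> = (\<integral>\<^sup>+ s. ennreal ((u s)\<^sup>2) \<partial>M) + (\<integral>\<^sup>+ s. ennreal ((w s)\<^sup>2) \<partial>M)"
    by (intro nn_integral_add) measurable
  finally show ?thesis .
qed

section \<open>The decreasing rearrangement\<close>

lemma distribution_fun_antimono:
  assumes [measurable]: "b \<in> borel_measurable M" and "\<sigma> \<le> \<tau>"
  shows "distribution_fun M b \<tau> \<le> distribution_fun M b \<sigma>"
  unfolding distribution_fun_def using assms(2) by (intro emeasure_mono) auto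

text \<open>Right-continuity of the distribution function, from continuity of the measure along
  \<open>{b > \<tau> + 1/n} \<up> {b > \<tau>}\<close>.\<close>

lemma distribution_fun_right_continuous:
  assumes [measurable]: "b \<in> borel_measurable M" and less: "c < distribution_fun M b \<tau>"
  obtains \<tau>' where "\<tau> < \<tau>'" "c < distribution_fun M b \<tau>'"
proof -
  define A where "A n = {s \<in> space M. b s > \<tau> + 1 / real (Suc n)}" for n
  have "incseq A"
  proof (rule incseq_SucI)
    fix n
    have "1 / real (Suc (Suc n)) \<le> 1 / real (Suc n)"
      by (simp add: field_simps)
    then show "A n \<subseteq> A (Suc n)" by (auto simp: A_def)
  qed
  moreover have "range A \<subseteq> sets M" by (auto simp: A_def)
  ultimately have "(SUP n. emeasure M (A n)) = emeasure M (\<Union>n. A n)"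
    by (intro SUP_emeasure_incseq)
  also have "(\<Union>n. A n) = {s \<in> space M. b s > \<tau>}"
  proof (intro set_eqI iffI)
    fix s assume "s \<in> {s \<in> space M. b s > \<tau>}"
    then obtain n where "1 / real (Suc n) < b s - \<tau>"
      using nat_approx_posE[of "b s - \<tau>"] by auto
    then show "s \<in> (\<Union>n. A n)"
      using \<open>s \<in> _\<close> by (auto simp: A_def intro!: exI[of _ n])
  next
    fix s assume "s \<in> (\<Union>n. A n)"
    then obtain n where s: "s \<in> space M" "b s > \<tau> + 1 / real (Suc n)"
      by (auto simp: A_def)
    have "1 / real (Suc n) > 0" by simp
    with s(2) have "\<tau> < b s" by linarith
    with s(1) show "s \<in> {s \<in> space M. b s > \<tau>}" by simp
  qed
  finally have "c < (SUP n. emeasure M (A n))"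
    using less by (simp add: distribution_fun_def)
  then obtain n where "c < emeasure M (A n)" by (auto simp: less_SUP_iff)
  then show ?thesis
    by (intro that[of "\<tau> + 1 / real (Suc n)"]) (simp_all add: A_def distribution_fun_def)
qed

text \<open>The rearrangement is a generalized inverse of the distribution function. Essential
  boundedness makes the set whose infimum is taken nonempty, even at \<open>t = 0\<close>; right-continuity
  keeps the infimum strictly above \<open>\<tau>\<close>.\<close>

lemma decreasing_rearrangement_greater_iff:
  assumes [measurable]: "b \<in> borel_measurable M" and bd: "AE s in M. b s \<le> bbar" and "\<tau> > 0"
  shows "decreasing_rearrangement M b t > \<tau> \<longleftrightarrow> ennreal t < distribution_fun M b \<tau>"
proof -
  define T where "T = {\<tau>. \<tau> > 0 \<and> distribution_fun M b \<tau> \<le> ennreal t}"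
  have Inf: "decreasing_rearrangement M b t = Inf T"
    by (simp add: decreasing_rearrangement_def T_def)
  show ?thesis
  proof
    assume "\<tau> < decreasing_rearrangement M b t"
    moreover have "bdd_below T" by (auto simp: T_def intro!: bdd_belowI[of _ 0])
    ultimately have "\<tau> \<notin> T" unfolding Inf using cInf_lower[of \<tau> T] by auto
    then show "ennreal t < distribution_fun M b \<tau>"
      using \<open>\<tau> > 0\<close> by (auto simp: T_def)
  next
    assume "ennreal t < distribution_fun M b \<tau>"
    then obtain \<tau>' where \<tau>': "\<tau> < \<tau>'" "ennreal t < distribution_fun M b \<tau>'"
      using distribution_fun_right_continuous[OF assms(1)] by blast
    have "AE s in M. \<not> b s > max bbar 1"
      using bd by eventually_elim auto
    then have "distribution_fun M b (max bbar 1) = 0"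
      unfolding distribution_fun_def by (subst (asm) AE_iff_measurable[OF _ refl]) auto
    then have "max bbar 1 \<in> T" by (simp add: T_def)
    moreover have "\<tau>' \<le> \<sigma>" if "\<sigma> \<in> T" for \<sigma>
    proof (rule ccontr)
      assume "\<not> \<tau>' \<le> \<sigma>"
      then have "distribution_fun M b \<tau>' \<le> distribution_fun M b \<sigma>"
        by (intro distribution_fun_antimono) auto
      with \<tau>' that show False by (auto simp: T_def)
    qed
    ultimately have "\<tau>' \<le> Inf T" by (intro cInf_greatest) auto
    with \<tau>' show "\<tau> < decreasing_rearrangement M b t" by (simp add: Inf)
  qed
qed

definition rearrangement_domain :: "'a measure \<Rightarrow> ('a \<Rightarrow> real) \<Rightarrow> real \<Rightarrow> real set" where
  "rearrangement_domain M b \<alpha> = {t. 0 \<le> t \<and> ennreal t < emeasure M (space M) \<and>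
     decreasing_rearrangement M b t > \<alpha>}"

lemma rearrangement_domain_eq:
  assumes [measurable]: "b \<in> borel_measurable M" and "AE s in M. b s \<le> bbar" and "\<alpha> > 0"
    and fin: "distribution_fun M b \<alpha> < \<infinity>"
  shows "rearrangement_domain M b \<alpha> = {0..<enn2real (distribution_fun M b \<alpha>)}"
proof -
  have "distribution_fun M b \<alpha> \<le> emeasure M (space M)"
    unfolding distribution_fun_def by (intro emeasure_mono) auto
  then have "rearrangement_domain M b \<alpha> = {t. 0 \<le> t \<and> ennreal t < distribution_fun M b \<alpha>}"
    unfolding rearrangement_domain_def
    by (auto simp: decreasing_rearrangement_greater_iff[OF assms(1-3)])
  also have "\<dots> = {0..<enn2real (distribution_fun M b \<alpha>)}"
    using fin by (cases "distribution_fun M b \<alpha>") (auto simp: ennreal_less_iff)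
  finally show ?thesis .
qed

lemma borel_measurable_decreasing_rearrangement:
  assumes "b \<in> borel_measurable M" and "AE s in M. b s \<le> bbar" and "\<alpha> > 0"
    and fin: "distribution_fun M b \<alpha> < \<infinity>"
  shows "decreasing_rearrangement M b \<in>
    borel_measurable (restrict_space lborel (rearrangement_domain M b \<alpha>))"
proof (rule borel_measurableI_greater)
  let ?A = "rearrangement_domain M b \<alpha>"
  have fin': "distribution_fun M b \<tau> < \<infinity>" if "\<alpha> \<le> \<tau>" for \<tau>
    using distribution_fun_antimono[OF assms(1) that] fin by simp
  have borel: "rearrangement_domain M b \<tau> \<in> sets lborel" if "\<alpha> \<le> \<tau>" for \<tau>
    using rearrangement_domain_eq[OF assms(1,2) _ fin'[OF that]] that \<open>\<alpha> > 0\<close> by simp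
  fix x
  have "?A \<inter> {t. x < decreasing_rearrangement M b t} = rearrangement_domain M b (max \<alpha> x)"
    by (auto simp: rearrangement_domain_def)
  moreover have "{t \<in> space (restrict_space lborel ?A). x < decreasing_rearrangement M b t} =
      ?A \<inter> {t. x < decreasing_rearrangement M b t}"
    by (auto simp: space_restrict_space)
  ultimately show "{t \<in> space (restrict_space lborel ?A). x < decreasing_rearrangement M b t}
      \<in> sets (restrict_space lborel ?A)"
    using borel[of \<alpha>] borel[of "max \<alpha> x"]
    by (subst sets_restrict_space_iff) (auto simp: rearrangement_domain_def)
qed

text \<open>Equimeasurability above the level \<open>\<alpha>\<close>. Finite measures on the line are determined by their
  values on the half-lines \<open>{x<..}\<close>, and here both values are the distribution function at
  \<open>max \<alpha> x\<close>.\<close>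

lemma distr_decreasing_rearrangement:
  assumes meas[measurable]: "b \<in> borel_measurable M" and bd: "AE s in M. b s \<le> bbar"
    and "\<alpha> > 0" and fin: "distribution_fun M b \<alpha> < \<infinity>"
  shows "distr (restrict_space lborel (rearrangement_domain M b \<alpha>)) borel
      (decreasing_rearrangement M b) =
    distr (restrict_space M {s \<in> space M. b s > \<alpha>}) borel b"
    (is "distr ?L _ ?r = distr ?N _ _")
proof (rule measure_eqI_lessThan)
  have r[measurable]: "?r \<in> borel_measurable ?L"
    by (rule borel_measurable_decreasing_rearrangement) fact+
  have bN[measurable]: "b \<in> borel_measurable ?N"
    by (rule measurable_restrict_space1) fact
  have fin': "distribution_fun M b \<tau> < \<infinity>" if "\<alpha> \<le> \<tau>" for \<tau>
    using distribution_fun_antimono[OF assms(1) that] fin by simp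
  have dom: "rearrangement_domain M b \<tau> = {0..<enn2real (distribution_fun M b \<tau>)}"
    if "\<alpha> \<le> \<tau>" for \<tau>
    using that \<open>\<alpha> > 0\<close> by (intro rearrangement_domain_eq[OF meas bd] fin') auto
  have L: "emeasure (distr ?L borel ?r) {x<..} = distribution_fun M b (max \<alpha> x)" for x
  proof -
    have "emeasure (distr ?L borel ?r) {x<..} = emeasure ?L (?r -` {x<..} \<inter> space ?L)"
      by (rule emeasure_distr) auto
    also have "?r -` {x<..} \<inter> space ?L = rearrangement_domain M b (max \<alpha> x)"
      by (auto simp: rearrangement_domain_def space_restrict_space)
    also have "emeasure ?L (rearrangement_domain M b (max \<alpha> x)) =
        emeasure lborel (rearrangement_domain M b (max \<alpha> x))"
      using dom[of \<alpha>] by (intro emeasure_restrict_space) (auto simp: rearrangement_domain_def)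
    also have "\<dots> = distribution_fun M b (max \<alpha> x)"
      using fin'[of "max \<alpha> x"] by (simp add: dom)
    finally show ?thesis .
  qed
  have N: "emeasure (distr ?N borel b) {x<..} = distribution_fun M b (max \<alpha> x)" for x
  proof -
    have "emeasure (distr ?N borel b) {x<..} = emeasure ?N (b -` {x<..} \<inter> space ?N)"
      by (rule emeasure_distr) auto
    also have "b -` {x<..} \<inter> space ?N = {s \<in> space M. b s > max \<alpha> x}"
      by (auto simp: space_restrict_space)
    also have "emeasure ?N \<dots> = emeasure M \<dots>"
      by (intro emeasure_restrict_space) auto
    finally show ?thesis by (simp add: distribution_fun_def)
  qed
  show "emeasure (distr ?L borel ?r) {x<..} = emeasure (distr ?N borel b) {x<..}" for x
    by (simp add: L N)
  show "emeasure (distr ?L borel ?r) {x<..} < \<infinity>" for x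
    using fin'[of "max \<alpha> x"] by (simp add: L)
qed simp_all

text \<open>The finiteness of the integral, needed to pass from the Bochner integral in the definition
  of \<open>D\<close> to a nonnegative integral, comes from \<open>1 / b\<^sup>2 \<le> 1 / \<alpha>\<^sup>2\<close> on a set of finite measure.\<close>

lemma stat_eff_illposedness_power2:
  assumes meas[measurable]: "b \<in> borel_measurable M" and bd: "AE s in M. b s \<le> bbar"
    and "\<alpha> > 0" and fin: "distribution_fun M b \<alpha> < \<infinity>"
  shows "ennreal ((stat_eff_illposedness M b \<alpha>)\<^sup>2) =
    (\<integral>\<^sup>+ s\<in>{s \<in> space M. b s > \<alpha>}. ennreal (1 / (b s)\<^sup>2) \<partial>M)"
proof -
  let ?A = "rearrangement_domain M b \<alpha>" and ?r = "decreasing_rearrangement M b"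
  let ?L = "restrict_space lborel ?A"
  let ?B = "{s \<in> space M. b s > \<alpha>}"
  let ?N = "restrict_space M ?B"
  have r[measurable]: "?r \<in> borel_measurable ?L"
    by (rule borel_measurable_decreasing_rearrangement) fact+
  have bN[measurable]: "b \<in> borel_measurable ?N"
    by (rule measurable_restrict_space1) fact
  have A: "?A \<in> sets lborel"
    using rearrangement_domain_eq[OF assms] by simp
  have "(\<integral>\<^sup>+ t. ennreal (1 / (?r t)\<^sup>2) \<partial>?L) =
      (\<integral>\<^sup>+ y. ennreal (1 / y\<^sup>2) \<partial>distr ?L borel ?r)"
    by (subst nn_integral_distr) auto
  also have "\<dots> = (\<integral>\<^sup>+ s. ennreal (1 / (b s)\<^sup>2) \<partial>?N)"
    unfolding distr_decreasing_rearrangement[OF assms]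
    by (subst nn_integral_distr) auto
  also have "\<dots> = (\<integral>\<^sup>+ s\<in>?B. ennreal (1 / (b s)\<^sup>2) \<partial>M)"
    by (rule nn_integral_restrict_space) auto
  finally have eq: "(\<integral>\<^sup>+ t. ennreal (1 / (?r t)\<^sup>2) \<partial>?L) = \<dots>" .
  have "\<dots> \<le> (\<integral>\<^sup>+ s. ennreal (1 / \<alpha>\<^sup>2) * indicator ?B s \<partial>M)"
    using \<open>\<alpha> > 0\<close>
    by (intro nn_integral_mono)
      (auto split: split_indicator intro!: ennreal_leI divide_left_mono power_mono)
  also have "\<dots> = ennreal (1 / \<alpha>\<^sup>2) * distribution_fun M b \<alpha>"
    unfolding distribution_fun_def by (rule nn_integral_cmult_indicator) auto
  also have "\<dots> < \<infinity>"
    using fin by (simp add: ennreal_mult_less_top)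
  finally have "(\<integral>\<^sup>+ t. ennreal (1 / (?r t)\<^sup>2) \<partial>?L) < \<infinity>"
    by (simp add: eq)
  moreover have "(LINT t:?A|lborel. 1 / \<bar>?r t\<bar>\<^sup>2) = (\<integral> t. 1 / (?r t)\<^sup>2 \<partial>?L)"
    unfolding set_lebesgue_integral_def using A by (subst integral_restrict_space) auto
  moreover have "(\<integral> t. 1 / (?r t)\<^sup>2 \<partial>?L) = enn2real (\<integral>\<^sup>+ t. ennreal (1 / (?r t)\<^sup>2) \<partial>?L)"
    by (rule integral_eq_nn_integral) auto
  ultimately have "ennreal (LINT t:?A|lborel. 1 / \<bar>?r t\<bar>\<^sup>2) =
      (\<integral>\<^sup>+ t. ennreal (1 / (?r t)\<^sup>2) \<partial>?L)"
    and "0 \<le> (LINT t:?A|lborel. 1 / \<bar>?r t\<bar>\<^sup>2)"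
    by (simp_all add: less_top)
  then show ?thesis
    using eq by (simp add: stat_eff_illposedness_def flip: rearrangement_domain_def)
qed

section \<open>Bounds for the bias and the variance\<close>

lemma bias_bound:
  assumes pos: "AE s in M. 0 < b s" and "\<alpha> > 0"
    and sc: "source_condition M \<phi> b f" and qual: "has_qualification \<Phi> \<phi> C\<phi>"
  shows "(\<integral>\<^sup>+ s. ennreal ((residual \<Phi> \<alpha> (b s) * f s)\<^sup>2) \<partial>M) \<le> ennreal (C\<phi>\<^sup>2 * (\<phi> \<alpha>)\<^sup>2)"
proof -
  obtain v where v: "v \<in> borel_measurable M" "L2_norm M v \<le> 1"
    "AE s in M. f s = \<phi> (b s) * v s"
    using sc by (auto simp: source_condition_def L2_space_def)
  have v1: "(\<integral>\<^sup>+ s. ennreal ((v s)\<^sup>2) \<partial>M) \<le> 1"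
    using v(2) ennsqrt_le_iff[of 1] by (simp add: L2_norm_def)
  have R: "\<bar>residual \<Phi> \<alpha> t\<bar> * \<phi> t \<le> C\<phi> * \<phi> \<alpha>" if "0 \<le> t" for t
  proof -
    have "ereal (\<bar>residual \<Phi> \<alpha> t\<bar> * \<phi> t) \<le> (SUP t\<in>{0..}. ereal (\<bar>residual \<Phi> \<alpha> t\<bar> * \<phi> t))"
      using that by (intro SUP_upper) auto
    also have "\<dots> \<le> ereal (C\<phi> * \<phi> \<alpha>)"
      using qual \<open>\<alpha> > 0\<close> by (simp add: has_qualification_def)
    finally show ?thesis by simp
  qed
  have pt: "(residual \<Phi> \<alpha> t * (\<phi> t * x))\<^sup>2 \<le> C\<phi>\<^sup>2 * (\<phi> \<alpha>)\<^sup>2 * x\<^sup>2" if "0 < t" for t x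
  proof -
    have "0 \<le> \<phi> t"
      using qual that by (simp add: has_qualification_def index_function_def)
    then have "(\<bar>residual \<Phi> \<alpha> t\<bar> * \<phi> t)\<^sup>2 \<le> (C\<phi> * \<phi> \<alpha>)\<^sup>2"
      using R[of t] that by (intro power_mono) auto
    then have "(\<bar>residual \<Phi> \<alpha> t\<bar> * \<phi> t)\<^sup>2 * x\<^sup>2 \<le> (C\<phi> * \<phi> \<alpha>)\<^sup>2 * x\<^sup>2"
      by (rule mult_right_mono) simp
    then show ?thesis by (simp add: power_mult_distrib mult.assoc)
  qed
  have "AE s in M. ennreal ((residual \<Phi> \<alpha> (b s) * f s)\<^sup>2) \<le>
      ennreal (C\<phi>\<^sup>2 * (\<phi> \<alpha>)\<^sup>2) * ennreal ((v s)\<^sup>2)"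
    using pos v(3) by eventually_elim (simp add: pt ennreal_leI flip: ennreal_mult)
  then have "(\<integral>\<^sup>+ s. ennreal ((residual \<Phi> \<alpha> (b s) * f s)\<^sup>2) \<partial>M) \<le>
      (\<integral>\<^sup>+ s. ennreal (C\<phi>\<^sup>2 * (\<phi> \<alpha>)\<^sup>2) * ennreal ((v s)\<^sup>2) \<partial>M)"
    by (rule nn_integral_mono_AE)
  also have "\<dots> = ennreal (C\<phi>\<^sup>2 * (\<phi> \<alpha>)\<^sup>2) * (\<integral>\<^sup>+ s. ennreal ((v s)\<^sup>2) \<partial>M)"
    using v(1) by (intro nn_integral_cmult) auto
  also have "\<dots> \<le> ennreal (C\<phi>\<^sup>2 * (\<phi> \<alpha>)\<^sup>2)"
    using mult_left_mono[OF v1, of "ennreal (C\<phi>\<^sup>2 * (\<phi> \<alpha>)\<^sup>2)"] by simp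
  finally show ?thesis .
qed

lemma filter_power2_le:
  assumes reg: "regularization \<Phi> Cm1 C0" and cut: "\<And>t. 0 \<le> t \<Longrightarrow> t \<le> \<alpha> \<Longrightarrow> \<Phi> \<alpha> t = 0"
    and "\<alpha> > 0" "0 \<le> t"
  shows "(\<Phi> \<alpha> t)\<^sup>2 \<le> (C0 + 1)\<^sup>2 * (if \<alpha> < t then 1 / t\<^sup>2 else 0)"
proof (cases "\<alpha> < t")
  case True
  have "\<bar>residual \<Phi> \<alpha> t\<bar> \<le> C0"
    using reg assms by (simp add: regularization_def)
  then have "\<bar>t * \<Phi> \<alpha> t\<bar> \<le> C0 + 1"
    by (simp add: residual_def)
  then have "(t * \<Phi> \<alpha> t)\<^sup>2 \<le> (C0 + 1)\<^sup>2"
    using power_mono[of "\<bar>t * \<Phi> \<alpha> t\<bar>" "C0 + 1" 2] by simp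
  then show ?thesis
    using True \<open>\<alpha> > 0\<close> by (simp add: field_simps power_mult_distrib)
qed (use assms in auto)

lemma variance_bound:
  assumes meas[measurable]: "b \<in> borel_measurable M"
    and rng: "AE s in M. 0 < b s \<and> b s \<le> bbar"
    and "\<alpha> > 0" and fin: "distribution_fun M b \<alpha> < \<infinity>"
    and reg: "regularization \<Phi> Cm1 C0" and cut: "\<And>t. 0 \<le> t \<Longrightarrow> t \<le> \<alpha> \<Longrightarrow> \<Phi> \<alpha> t = 0"
  shows "(\<integral>\<^sup>+ s. ennreal ((\<delta> * \<Phi> \<alpha> (b s))\<^sup>2) \<partial>M) \<le>
    ennreal (\<delta>\<^sup>2 * (C0 + 1)\<^sup>2 * (stat_eff_illposedness M b \<alpha>)\<^sup>2)"
proof -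
  let ?B = "{s \<in> space M. b s > \<alpha>}"
  let ?c = "\<delta>\<^sup>2 * (C0 + 1)\<^sup>2"
  have bd: "AE s in M. b s \<le> bbar" using rng by eventually_elim simp
  have "AE s in M. ennreal ((\<delta> * \<Phi> \<alpha> (b s))\<^sup>2) \<le>
      ennreal ?c * (ennreal (1 / (b s)\<^sup>2) * indicator ?B s)"
    using rng AE_space
  proof eventually_elim
    case (elim s)
    have "(\<delta> * \<Phi> \<alpha> (b s))\<^sup>2 \<le> \<delta>\<^sup>2 * ((C0 + 1)\<^sup>2 * (if \<alpha> < b s then 1 / (b s)\<^sup>2 else 0))"
      unfolding power_mult_distrib
      using elim by (intro mult_left_mono filter_power2_le[OF reg cut \<open>\<alpha> > 0\<close>]) auto
    then have "ennreal ((\<delta> * \<Phi> \<alpha> (b s))\<^sup>2) \<le>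
        ennreal (?c * (if \<alpha> < b s then 1 / (b s)\<^sup>2 else 0))"
      by (intro ennreal_leI) (simp add: mult.assoc)
    also have "\<dots> = ennreal ?c * (ennreal (1 / (b s)\<^sup>2) * indicator ?B s)"
      using elim by (auto simp: ennreal_mult')
    finally show ?case .
  qed
  then have "(\<integral>\<^sup>+ s. ennreal ((\<delta> * \<Phi> \<alpha> (b s))\<^sup>2) \<partial>M) \<le>
      (\<integral>\<^sup>+ s. ennreal ?c * (ennreal (1 / (b s)\<^sup>2) * indicator ?B s) \<partial>M)"
    by (rule nn_integral_mono_AE)
  also have "\<dots> = ennreal ?c * (\<integral>\<^sup>+ s\<in>?B. ennreal (1 / (b s)\<^sup>2) \<partial>M)"
    by (intro nn_integral_cmult) measurable
  also have "\<dots> = ennreal (?c * (stat_eff_illposedness M b \<alpha>)\<^sup>2)"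
    by (simp add: stat_eff_illposedness_power2[OF meas bd \<open>\<alpha> > 0\<close> fin, symmetric] ennreal_mult)
  finally show ?thesis .
qed

section \<open>The error bound\<close>

text \<open>The filter \<open>\<Phi>\<^sub>\<alpha>\<close> is a Borel function on the half-line only, while \<open>b\<close> may be negative on a
  null set, so \<open>\<Phi>\<^sub>\<alpha>(b)\<close> itself need not be measurable. Replacing \<open>b\<close> by \<open>max 0 b\<close> repairs this
  and changes neither side.\<close>

lemma mean_square_error_eq:
  assumes sf: "sigma_finite_measure M" and wn: "white_noise M P \<xi>"
    and [measurable]: "b \<in> borel_measurable M" "f \<in> borel_measurable M"
    and pos: "AE s in M. 0 < b s"
    and reg: "regularization \<Phi> Cm1 C0" and "\<alpha> > 0"
  shows "mean_square_error M P f (\<lambda>\<omega>. reconstruction \<Phi> \<alpha> b (noisy_data b f \<delta> \<xi> \<omega>)) =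
    (\<integral>\<^sup>+ s. ennreal ((residual \<Phi> \<alpha> (b s) * f s)\<^sup>2) \<partial>M) +
    (\<integral>\<^sup>+ s. ennreal ((\<delta> * \<Phi> \<alpha> (b s))\<^sup>2) \<partial>M)"
proof -
  define b' where "b' s = max 0 (b s)" for s
  have eq: "AE s in M. b s = b' s"
    using pos by eventually_elim (simp add: b'_def)
  have b'[measurable]: "b' \<in> borel_measurable M" unfolding b'_def by measurable
  have "b' \<in> measurable M (restrict_space borel {0..})"
    by (rule measurable_restrict_space2) (auto simp: b'_def)
  moreover have "\<Phi> \<alpha> \<in> borel_measurable (restrict_space borel {0..})"
    using reg \<open>\<alpha> > 0\<close> by (simp add: regularization_def)
  ultimately have [measurable]: "(\<lambda>s. \<Phi> \<alpha> (b' s)) \<in> borel_measurable M"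
    by (rule measurable_compose)
  let ?u = "\<lambda>s. residual \<Phi> \<alpha> (b' s) * f s" and ?w = "\<lambda>s. \<delta> * \<Phi> \<alpha> (b' s)"
  have "L2_norm M (\<lambda>s. f s - reconstruction \<Phi> \<alpha> b (noisy_data b f \<delta> \<xi> \<omega>) s) =
      L2_norm M (\<lambda>s. ?u s - ?w s * \<xi> s \<omega>)" for \<omega>
    unfolding L2_norm_def
    by (intro arg_cong[where f = ennsqrt] nn_integral_cong_AE, use eq in eventually_elim)
      (simp add: reconstruction_def noisy_data_def residual_def algebra_simps)
  then have "mean_square_error M P f (\<lambda>\<omega>. reconstruction \<Phi> \<alpha> b (noisy_data b f \<delta> \<xi> \<omega>)) =
      (\<integral>\<^sup>+ \<omega>. (L2_norm M (\<lambda>s. ?u s - ?w s * \<xi> s \<omega>))\<^sup>2 \<partial>P)"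
    by (simp add: mean_square_error_def)
  also have "\<dots> = (\<integral>\<^sup>+ s. ennreal ((?u s)\<^sup>2) \<partial>M) + (\<integral>\<^sup>+ s. ennreal ((?w s)\<^sup>2) \<partial>M)"
    by (rule bias_variance_decomposition[OF sf wn]) (unfold residual_def, measurable)
  also have "(\<integral>\<^sup>+ s. ennreal ((?u s)\<^sup>2) \<partial>M) =
      (\<integral>\<^sup>+ s. ennreal ((residual \<Phi> \<alpha> (b s) * f s)\<^sup>2) \<partial>M)"
    by (intro nn_integral_cong_AE, use eq in eventually_elim) simp
  also have "(\<integral>\<^sup>+ s. ennreal ((?w s)\<^sup>2) \<partial>M) = (\<integral>\<^sup>+ s. ennreal ((\<delta> * \<Phi> \<alpha> (b s))\<^sup>2) \<partial>M)"
    by (intro nn_integral_cong_AE, use eq in eventually_elim) simp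
  finally show ?thesis .
qed

theorem proposition4:
  fixes M :: "'a measure" and P :: "'w measure"
    and b f :: "'a \<Rightarrow> real" and bbar \<delta> :: real
    and \<phi> :: "real \<Rightarrow> real" and \<Phi> :: "real \<Rightarrow> real \<Rightarrow> real" and Cm1 C0 C\<phi> :: real
    and \<xi> :: "'a \<Rightarrow> 'w \<Rightarrow> real"
  assumes "sigma_finite_measure M"
    and "b \<in> borel_measurable M"
    and "AE s in M. 0 < b s \<and> b s \<le> bbar"
    and "essinf M b = 0"
    and "\<delta> > 0"
    and "index_function \<phi>"
    and "f \<in> L2_space M"
    and "source_condition M \<phi> b f"
    and "regularization \<Phi> Cm1 C0"
    and "has_qualification \<Phi> \<phi> C\<phi>"
    and "emeasure M (space M) = \<infinity> \<Longrightarrow> (\<forall>t>0. emeasure M {s \<in> space M. b s > t} < \<infinity>)"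
    and "\<forall>\<alpha>>0. \<forall>t\<ge>0. t \<le> \<alpha> \<longrightarrow> \<Phi> \<alpha> t = 0"
    and "white_noise M P \<xi>"
  shows "(\<forall>\<alpha>>0.
            mean_square_error M P f (\<lambda>\<omega>. reconstruction \<Phi> \<alpha> b (noisy_data b f \<delta> \<xi> \<omega>))
              \<le> ennreal (C\<phi>\<^sup>2 * (\<phi> \<alpha>)\<^sup>2
                          + \<delta>\<^sup>2 * (C0 + 1)\<^sup>2 * (stat_eff_illposedness M b \<alpha>)\<^sup>2)) \<and>
         (\<forall>\<alpha>>0. \<phi> \<alpha> = \<delta> * stat_eff_illposedness M b \<alpha> \<longrightarrow>
            ennsqrt (mean_square_error M P f (\<lambda>\<omega>. reconstruction \<Phi> \<alpha> b (noisy_data b f \<delta> \<xi> \<omega>)))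
              \<le> ennreal (sqrt 2 * max C\<phi> (C0 + 1) * \<phi> \<alpha>))"
proof -
  have f[measurable]: "f \<in> borel_measurable M"
    using assms(7) by (simp add: L2_space_def)
  have pos: "AE s in M. 0 < b s" using assms(3) by eventually_elim simp
  have fin: "distribution_fun M b \<alpha> < \<infinity>" if "\<alpha> > 0" for \<alpha>
  proof (cases "emeasure M (space M) = \<infinity>")
    case True
    then show ?thesis using assms(11) that by (simp add: distribution_fun_def)
  next
    case False
    have "distribution_fun M b \<alpha> \<le> emeasure M (space M)"
      unfolding distribution_fun_def using assms(2) by (intro emeasure_mono) auto
    with False show ?thesis by (simp add: top.not_eq_extremum le_less_trans)
  qed
  let ?mse = "\<lambda>\<alpha>. mean_square_error M P f
    (\<lambda>\<omega>. reconstruction \<Phi> \<alpha> b (noisy_data b f \<delta> \<xi> \<omega>))"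
  let ?D = "stat_eff_illposedness M b"
  have bound: "?mse \<alpha> \<le> ennreal (C\<phi>\<^sup>2 * (\<phi> \<alpha>)\<^sup>2 + \<delta>\<^sup>2 * (C0 + 1)\<^sup>2 * (?D \<alpha>)\<^sup>2)"
    if "\<alpha> > 0" for \<alpha>
  proof -
    have "?mse \<alpha> \<le> ennreal (C\<phi>\<^sup>2 * (\<phi> \<alpha>)\<^sup>2) + ennreal (\<delta>\<^sup>2 * (C0 + 1)\<^sup>2 * (?D \<alpha>)\<^sup>2)"
      unfolding mean_square_error_eq[OF assms(1,13,2) f pos assms(9) that]
      using assms(12) that
      by (intro add_mono bias_bound[OF pos that assms(8,10)]
          variance_bound[OF assms(2,3) that fin[OF that] assms(9)]) auto
    then show ?thesis by (simp add: ennreal_plus)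
  qed
  moreover have "ennsqrt (?mse \<alpha>) \<le> ennreal (sqrt 2 * max C\<phi> (C0 + 1) * \<phi> \<alpha>)"
    if "\<alpha> > 0" and bal: "\<phi> \<alpha> = \<delta> * ?D \<alpha>" for \<alpha>
  proof -
    let ?m = "max C\<phi> (C0 + 1)"
    have C: "0 < C\<phi>" "0 < C0 + 1" and "0 \<le> \<phi> \<alpha>"
      using assms(6,9,10) that
      by (auto simp: has_qualification_def regularization_def index_function_def)
    have "C\<phi>\<^sup>2 \<le> ?m\<^sup>2" "(C0 + 1)\<^sup>2 \<le> ?m\<^sup>2"
      using C by (auto intro!: power_mono)
    then have "(C\<phi>\<^sup>2 + (C0 + 1)\<^sup>2) * (\<phi> \<alpha>)\<^sup>2 \<le> (2 * ?m\<^sup>2) * (\<phi> \<alpha>)\<^sup>2"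
      by (intro mult_right_mono) auto
    moreover have "C\<phi>\<^sup>2 * (\<phi> \<alpha>)\<^sup>2 + \<delta>\<^sup>2 * (C0 + 1)\<^sup>2 * (?D \<alpha>)\<^sup>2 =
        (C\<phi>\<^sup>2 + (C0 + 1)\<^sup>2) * (\<phi> \<alpha>)\<^sup>2"
      by (simp add: bal power_mult_distrib algebra_simps)
    ultimately have "C\<phi>\<^sup>2 * (\<phi> \<alpha>)\<^sup>2 + \<delta>\<^sup>2 * (C0 + 1)\<^sup>2 * (?D \<alpha>)\<^sup>2 \<le>
        (sqrt 2 * ?m * \<phi> \<alpha>)\<^sup>2"
      by (simp add: power_mult_distrib)
    with bound[OF \<open>\<alpha> > 0\<close>] have "?mse \<alpha> \<le> ennreal ((sqrt 2 * ?m * \<phi> \<alpha>)\<^sup>2)"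
      by (meson ennreal_leI order_trans)
    moreover have "0 \<le> sqrt 2 * ?m * \<phi> \<alpha>"
      using C \<open>0 \<le> \<phi> \<alpha>\<close> by (simp add: max_def)
    ultimately show ?thesis by (simp add: ennsqrt_le_iff)
  qed
  ultimately show ?thesis by blast
qed

end
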